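(* Let $(X,\langle\cdot|\cdot\rangle)$ be a complex Hilbert space and let $x,y\in X\setminus\{0\}$ with $x\neq y$. If the angle $\angle(x,y)$ is real, then $$\angle(x,y)+\angle(-x,\,y-x)+\angle(-y,\,x-y)=\pi.$$
   Context: A complex Hilbert space is a complete complex inner product space; the inner product is homogeneous over $\mathbb C$ in the first component, conjugate symmetric, positive definite and additive, and $\|x\|=\sqrt{\langle x|x\rangle}$. For $x,y\in X\setminus\{0\}$ the angle is $\angle(x,y):=\arccos\big(\langle x|y\rangle/(\|x\|\,\|y\|)\big)$, where $\arccos:\mathcal B\to\mathcal A$ is the inverse of the homeomorphism $\cos:\mathcal A\to\mathcal B$ obtained by restricting the complex cosine, with $\mathcal A:=\{a+ib\mid 0<a<\pi,\ b\in\mathbb R\}\cup\{0,\pi\}$ and $\mathcal B:=\mathbb C\setminus\{r\in\mathbb R\mid r<-1\text{ or }r>1\}$. *)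

theory Defs
  imports "HOL-Analysis.Analysis"
begin

definition arccos_range :: "complex set" where
  "arccos_range = {z. 0 < Re z \<and> Re z < pi} \<union> {0, complex_of_real pi}"

definition arccos_domain :: "complex set" where
  "arccos_domain = UNIV - complex_of_real ` {r. r < -1 \<or> 1 < r}"

lemma bij_betw_cos_arccos_range: "bij_betw cos arccos_range arccos_domain"
proof (rule bij_betw_imageI)
  have Arccos_cos': "Arccos (cos z) = z" if "z \<in> arccos_range" for z
    using that by (intro Arccos_cos) (auto simp: arccos_range_def)
  then show "inj_on cos arccos_range"
    by (metis inj_onI)
  show "cos ` arccos_range = arccos_domain"
  proof (intro equalityI subsetI)
    fix w assume "w \<in> cos ` arccos_range"
    then obtain z where z: "z \<in> arccos_range" and w: "w = cos z" by auto
    have False if "w = complex_of_real r" "r < -1 \<or> 1 < r" for r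
    proof (cases "z = 0 \<or> z = complex_of_real pi")
      case True
      then show False
      proof
        assume "z = 0"
        with w that(1) have "r = 1" by simp
        with that(2) show False by simp
      next
        assume "z = complex_of_real pi"
        with w that(1) have "complex_of_real r = complex_of_real (-1)"
          by (simp add: cos_of_real)
        then have "r = -1" by (simp only: of_real_eq_iff)
        with that(2) show False by simp
      qed
    next
      case False
      with z have b: "0 < Re z" "Re z < pi"
        by (auto simp: arccos_range_def)
      then have s: "sin (Re z) \<noteq> 0"
        using sin_gt_zero by fastforce
      have "Im (cos z) = 0"
        unfolding w[symmetric] that(1) by (rule Im_complex_of_real)
      then have "Im z = 0"
        using s by (simp add: Im_cos)
      then have "z = complex_of_real (Re z)"
        by (simp add: complex_eq_iff)
      then have "cos z = complex_of_real (cos (Re z))"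
        by (metis cos_of_real)
      then have "r = cos (Re z)"
        using w that(1) by simp
      with that(2) show False
        using cos_le_one[of "Re z"] cos_ge_minus_one[of "Re z"] by linarith
    qed
    then show "w \<in> arccos_domain"
      by (auto simp: arccos_domain_def)
  next
    fix w assume w: "w \<in> arccos_domain"
    have "Arccos w \<in> arccos_range"
    proof (cases "Im w = 0")
      case True
      then have wr: "w = complex_of_real (Re w)"
        by (simp add: complex_eq_iff)
      have r: "\<bar>Re w\<bar> \<le> 1"
      proof (rule ccontr)
        assume "\<not> \<bar>Re w\<bar> \<le> 1"
        then have "Re w \<in> {r. r < -1 \<or> 1 < r}" by auto
        with wr w show False
          unfolding arccos_domain_def by blast
      qed
      then have A: "Arccos w = complex_of_real (arccos (Re w))"
        using of_real_arccos[of "Re w"] wr by simp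
      have "0 \<le> arccos (Re w)" "arccos (Re w) \<le> pi"
        using r by (auto intro: arccos_lbound arccos_ubound)
      then show ?thesis
        unfolding A arccos_range_def by auto
    next
      case False
      define z where "z = Arccos w"
      have c: "cos z = w" by (simp add: z_def)
      have "- pi < Re z" "Re z \<le> pi"
        using Re_Arccos_bounds by (auto simp: z_def)
      moreover have "sin (Re z) \<noteq> 0"
        using False c by (auto simp: Im_cos)
      moreover have "Re z \<ge> 0"
      proof -
        define s where "s = csqrt (1 - w\<^sup>2)"
        have "0 \<le> Im (w + \<i> * s)"
        proof (rule ccontr)
          assume "\<not> 0 \<le> Im (w + \<i> * s)"
          then have neg: "Im w + Re s < 0" by simp
          have s2: "s\<^sup>2 = 1 - w\<^sup>2" by (simp add: s_def)
          have R: "0 \<le> Re s" unfolding s_def by (rule Re_csqrt)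
          have "Re (s\<^sup>2) = Re (1 - w\<^sup>2)" "Im (s\<^sup>2) = Im (1 - w\<^sup>2)"
            using s2 by auto
          then have e1: "(Re s)\<^sup>2 - (Im s)\<^sup>2 = 1 - (Re w)\<^sup>2 + (Im w)\<^sup>2"
            and e2: "Re s * Im s = - (Re w * Im w)"
            by (simp_all add: power2_eq_square mult.commute)
          have lt: "(Re s)\<^sup>2 < (Im w)\<^sup>2"
          proof -
            have "Re s < - Im w" using neg by simp
            then show ?thesis
              using R by (metis power2_minus power_strict_mono zero_less_numeral)
          qed
          have "(Im s)\<^sup>2 < (Re w)\<^sup>2"
            using e1 lt by linarith
          then have "(Re s)\<^sup>2 * (Im s)\<^sup>2 < (Im w)\<^sup>2 * (Re w)\<^sup>2"
            using lt by (intro mult_strict_mono) (auto intro: le_less_trans[OF zero_le_power2])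
          moreover have "(Re s)\<^sup>2 * (Im s)\<^sup>2 = (Im w)\<^sup>2 * (Re w)\<^sup>2"
            using e2 by (metis mult.commute power2_minus power_mult_distrib)
          ultimately show False by simp
        qed
        then show ?thesis
          unfolding z_def Re_Arccos s_def
          using Im_Ln_pos_le[OF Arccos_body_lemma] by blast
      qed
      ultimately have "0 < Re z" "Re z < pi"
        by (auto simp: order_less_le)
      then show ?thesis
        by (simp add: arccos_range_def z_def)
    qed
    then show "w \<in> cos ` arccos_range"
      by (metis cos_Arccos image_eqI)
  qed
qed

text \<open>Meaningful on \<^const>\<open>arccos_domain\<close> only.\<close>
definition complex_arccos :: "complex \<Rightarrow> complex" where
  "complex_arccos = the_inv_into arccos_range cos"

lemma complex_arccos_eq_Arccos: "complex_arccos z = Arccos z" if "z \<in> arccos_domain"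
proof -
  have "z \<in> cos ` arccos_range"
    by (simp only: bij_betw_imp_surj_on[OF bij_betw_cos_arccos_range] that)
  then obtain w where w: "w \<in> arccos_range" "cos w = z"
    by (elim imageE) simp
  have "complex_arccos z = w"
    unfolding complex_arccos_def
    by (rule the_inv_into_f_eq[OF bij_betw_imp_inj_on[OF bij_betw_cos_arccos_range] w(2,1)])
  moreover have "Arccos z = w"
    using w(1) by (intro Arccos_unique[OF w(2)]) (auto simp: arccos_range_def)
  ultimately show ?thesis by simp
qed

definition ip_norm :: "('a \<Rightarrow> 'a \<Rightarrow> complex) \<Rightarrow> 'a \<Rightarrow> real" where
  "ip_norm ip x = sqrt (Re (ip x x))"

text \<open>For nonzero vectors the quotient has modulus at most 1 by Cauchy--Schwarz, so it lies in
  \<^const>\<open>arccos_domain\<close>.\<close>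
definition ip_angle :: "('a \<Rightarrow> 'a \<Rightarrow> complex) \<Rightarrow> 'a \<Rightarrow> 'a \<Rightarrow> complex" where
  "ip_angle ip x y = complex_arccos (ip x y / complex_of_real (ip_norm ip x * ip_norm ip y))"

locale complex_inner_product_space = vector_space scale
  for scale :: "complex \<Rightarrow> 'a::ab_group_add \<Rightarrow> 'a" +
  fixes ip :: "'a \<Rightarrow> 'a \<Rightarrow> complex"
  assumes ip_scale_left: "ip (scale c x) y = c * ip x y"
    and ip_add_left: "ip (x + y) z = ip x z + ip y z"
    and ip_commute: "ip x y = cnj (ip y x)"
    and ip_pos: "x \<noteq> 0 \<Longrightarrow> ip x x \<in> \<real> \<and> 0 < Re (ip x x)"
begin

lemma ip_zero_left [simp]: "ip 0 y = 0"
  using ip_add_left[of 0 0 y] by simp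

lemma ip_minus_left [simp]: "ip (- x) y = - ip x y"
  using ip_add_left[of x "- x" y] by (simp add: eq_neg_iff_add_eq_0 add.commute)

lemma ip_diff_left: "ip (x - y) z = ip x z - ip y z"
  using ip_add_left[of x "- y" z] by simp

lemma ip_zero_right [simp]: "ip x 0 = 0"
  by (subst ip_commute) simp

lemma ip_minus_right [simp]: "ip x (- y) = - ip x y"
  by (subst (1 2) ip_commute) simp

lemma ip_add_right: "ip x (y + z) = ip x y + ip x z"
  by (subst (1 2 3) ip_commute) (simp add: ip_add_left)

lemma ip_diff_right: "ip x (y - z) = ip x y - ip x z"
  by (subst (1 2 3) ip_commute) (simp add: ip_diff_left)

lemma ip_scale_right: "ip x (scale c y) = cnj c * ip x y"
  by (subst (1 2) ip_commute) (simp add: ip_scale_left)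

lemma Re_ip_nonneg: "0 \<le> Re (ip x x)"
  using ip_pos[of x] by (cases "x = 0") auto

lemma ip_norm_nonneg: "0 \<le> ip_norm ip x"
  by (simp add: ip_norm_def Re_ip_nonneg)

lemma ip_norm_eq_zero_iff [simp]: "ip_norm ip x = 0 \<longleftrightarrow> x = 0"
  using ip_pos[of x] by (cases "x = 0") (auto simp: ip_norm_def)

lemma ip_norm_power2: "(ip_norm ip x)\<^sup>2 = Re (ip x x)"
  by (simp add: ip_norm_def Re_ip_nonneg)

lemma ip_self: "ip x x = complex_of_real ((ip_norm ip x)\<^sup>2)"
  unfolding ip_norm_power2 using ip_pos[of x] by (cases "x = 0") auto

lemma ip_Cauchy_Schwarz: "cmod (ip x y) \<le> ip_norm ip x * ip_norm ip y"
proof (cases "y = 0")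
  case False
  define N where "N = (ip_norm ip y)\<^sup>2"
  have N: "N > 0" using False by (simp add: N_def)
  define c where "c = ip x y / complex_of_real N"
  have yx: "ip y x = cnj (ip x y)" by (rule ip_commute)
  have "ip (x - scale c y) (x - scale c y)
      = ip x x - c * ip y x - cnj c * ip x y + c * cnj c * ip y y"
    by (simp add: ip_diff_left ip_diff_right ip_scale_left ip_scale_right algebra_simps)
  also have "\<dots> = complex_of_real ((ip_norm ip x)\<^sup>2 - (cmod (ip x y))\<^sup>2 / N)"
    using N unfolding ip_self yx N_def[symmetric] c_def
    by (simp add: field_simps complex_norm_square del: of_real_power)
  finally have "0 \<le> (ip_norm ip x)\<^sup>2 - (cmod (ip x y))\<^sup>2 / N"
    using Re_ip_nonneg[of "x - scale c y"] by simp
  then have "(cmod (ip x y))\<^sup>2 \<le> (ip_norm ip x * ip_norm ip y)\<^sup>2"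
    using N by (simp add: field_simps N_def power_mult_distrib)
  then show ?thesis
    by (rule power2_le_imp_le) (simp add: ip_norm_nonneg)
qed (simp add: ip_norm_nonneg)

lemma ip_norm_triangle: "ip_norm ip (x + y) \<le> ip_norm ip x + ip_norm ip y"
proof (rule power2_le_imp_le)
  have "(ip_norm ip (x + y))\<^sup>2 = (ip_norm ip x)\<^sup>2 + 2 * Re (ip x y) + (ip_norm ip y)\<^sup>2"
    using arg_cong[OF ip_commute[of y x], of Re]
    by (simp add: ip_norm_power2 ip_add_left ip_add_right)
  also have "\<dots> \<le> (ip_norm ip x + ip_norm ip y)\<^sup>2"
    using complex_Re_le_cmod[of "ip x y"] ip_Cauchy_Schwarz[of x y]
    by (simp add: power2_sum)
  finally show "(ip_norm ip (x + y))\<^sup>2 \<le> (ip_norm ip x + ip_norm ip y)\<^sup>2" .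
qed (simp add: ip_norm_nonneg)

sublocale Metric_space UNIV "\<lambda>x y. ip_norm ip (x - y)"
proof
  fix x y z :: 'a
  show "ip_norm ip (x - y) = ip_norm ip (y - x)"
    by (simp add: ip_norm_def ip_diff_left ip_diff_right)
  show "ip_norm ip (x - z) \<le> ip_norm ip (x - y) + ip_norm ip (y - z)"
    using ip_norm_triangle[of "x - y" "y - z"] by simp
qed (simp_all add: ip_norm_nonneg)

end

locale complex_hilbert_space = complex_inner_product_space +
  assumes complete: mcomplete

end

theory Submission
  imports Defs
begin

text \<open>Since \<open>cos\<close> inverts \<open>arccos\<close>, a real angle forces \<open>\<langle>x|y\<rangle>\<close> to be real. All three angles
  are then those of the Euclidean triangle with sides \<open>a = \<parallel>x\<parallel>\<close>, \<open>b = \<parallel>y\<parallel>\<close>, \<open>n = \<parallel>x - y\<parallel>\<close>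
  and \<open>\<langle>x|y\<rangle> = c\<close>. Their sines are \<open>D / (a * b)\<close>, \<open>D / (a * n)\<close>, \<open>D / (b * n)\<close> with
  \<open>D\<^sup>2 = a\<^sup>2 * b\<^sup>2 - c\<^sup>2\<close>, and the addition theorems determine the sum.\<close>

lemma arccos_triangle_sum:
  fixes a b c n :: real
  assumes "a > 0" "b > 0" "n > 0"
    and c: "\<bar>c\<bar> \<le> a * b"
    and n: "n\<^sup>2 = a\<^sup>2 + b\<^sup>2 - 2 * c"
  shows "arccos (c / (a * b)) + arccos ((a\<^sup>2 - c) / (a * n)) + arccos ((b\<^sup>2 - c) / (b * n)) = pi"
proof -
  \<comment> \<open>\<open>D\<close> is twice the area of the triangle; the bound on
    \<open>c\<close> makes the radicand nonnegative.\<close>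
  define D where "D = sqrt ((a * b)\<^sup>2 - c\<^sup>2)"
  have "c\<^sup>2 \<le> (a * b)\<^sup>2"
    using power_mono[OF c, of 2] by simp
  then have D: "D \<ge> 0" and D2: "D\<^sup>2 = (a * b)\<^sup>2 - c\<^sup>2"
    by (simp_all add: D_def)
  \<comment> \<open>A right triangle with legs \<open>u\<close>, \<open>D\<close> and hypotenuse
    \<open>v\<close>: \<open>D\<close> serves as the common opposite leg for both angles
    \<open>B\<close> and \<open>C\<close>.\<close>
  have angle: "\<bar>u / v\<bar> \<le> 1 \<and> sin (arccos (u / v)) = D / v"
    if v: "v > 0" and uv: "u\<^sup>2 + D\<^sup>2 = v\<^sup>2" for u v :: real
  proof
    have sq: "(u / v)\<^sup>2 + (D / v)\<^sup>2 = 1"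
      using v by (simp add: power_divide uv flip: add_divide_distrib)
    then have "(u / v)\<^sup>2 \<le> 1"
      using zero_le_power2[of "D / v"] by linarith
    then show le: "\<bar>u / v\<bar> \<le> 1"
      by (simp add: abs_square_le_1)
    have "1 - (u / v)\<^sup>2 = (D / v)\<^sup>2"
      using sq by linarith
    then have "sin (arccos (u / v)) = sqrt ((D / v)\<^sup>2)"
      using sin_arccos_abs[OF le] by (simp only:)
    then show "sin (arccos (u / v)) = D / v"
      using D v by simp
  qed
  define B where "B = arccos ((a\<^sup>2 - c) / (a * n))"
  define C where "C = arccos ((b\<^sup>2 - c) / (b * n))"
  have "(a\<^sup>2 - c)\<^sup>2 + D\<^sup>2 = (a * n)\<^sup>2" "(b\<^sup>2 - c)\<^sup>2 + D\<^sup>2 = (b * n)\<^sup>2"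
    unfolding D2 power_mult_distrib n by algebra+
  then have Ble: "\<bar>(a\<^sup>2 - c) / (a * n)\<bar> \<le> 1" and sinB: "sin B = D / (a * n)"
    and Cle: "\<bar>(b\<^sup>2 - c) / (b * n)\<bar> \<le> 1" and sinC: "sin C = D / (b * n)"
    using angle[of "a * n" "a\<^sup>2 - c"] angle[of "b * n" "b\<^sup>2 - c"] assms(1-3)
    unfolding B_def C_def by simp_all
  have cosB: "cos B = (a\<^sup>2 - c) / (a * n)" and cosC: "cos C = (b\<^sup>2 - c) / (b * n)"
    unfolding B_def C_def using Ble Cle by (simp_all only: cos_arccos_abs)
  have bounds: "0 \<le> B" "B \<le> pi" "0 \<le> C" "C \<le> pi"
    unfolding B_def C_def using Ble Cle
    by (auto simp only: abs_le_iff intro!: arccos_lbound arccos_ubound)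
  \<comment> \<open>Over the common denominator the numerator is
    \<open>D * (b\<^sup>2 - c) + D * (a\<^sup>2 - c)\<close>, and its second factor is
    \<open>n\<^sup>2\<close> by the law of cosines.\<close>
  have "sin (B + C) = D * (a\<^sup>2 + b\<^sup>2 - 2 * c) / (a * b * n\<^sup>2)"
    using assms(1-3) unfolding sin_add sinB sinC cosB cosC
    by (simp add: field_simps power2_eq_square)
  also have "\<dots> = D / (a * b)"
    using assms(3) unfolding n[symmetric] by simp
  finally have sin_ge: "sin (B + C) \<ge> 0"
    using D assms(1,2) by simp
  have "cos (B + C) = ((a\<^sup>2 - c) * (b\<^sup>2 - c) - D\<^sup>2) / (a * b * n\<^sup>2)"
    using assms(1-3) unfolding cos_add sinB sinC cosB cosC
    by (simp add: field_simps power2_eq_square)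
  also have "(a\<^sup>2 - c) * (b\<^sup>2 - c) - D\<^sup>2 = - c * n\<^sup>2"
    unfolding D2 n by algebra
  finally have cos_sum: "cos (B + C) = - (c / (a * b))"
    using assms(3) by simp
  \<comment> \<open>The cosine determines \<open>B + C\<close> only within [0, pi], whereas the
    bounds on \<open>B\<close> and \<open>C\<close> give just [0, 2 pi].\<close>
  have "B + C \<le> pi"
  proof (rule ccontr)
    assume gt: "\<not> B + C \<le> pi"
    \<comment> \<open>The sine is negative strictly between pi and 2 pi, so only the endpoint 2 pi
      remains, which forces both angles to be pi.\<close>
    have "\<not> B + C < 2 * pi"
      using sin_lt_zero[of "B + C"] sin_ge gt by linarith
    then have "B = pi" "C = pi"
      using bounds by linarith+
    then have "a\<^sup>2 - c = - (a * n)" "b\<^sup>2 - c = - (b * n)"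
      using cosB cosC assms(1-3) by (simp_all add: field_simps)
    \<comment> \<open>The sum of the two equations; its sides have opposite signs.\<close>
    then have "n\<^sup>2 = - ((a + b) * n)"
      using n by (simp add: algebra_simps)
    moreover have "n\<^sup>2 > 0" "(a + b) * n > 0"
      using assms(1-3) by simp_all
    ultimately show False
      by linarith
  qed
  then have "B + C = arccos (- (c / (a * b)))"
    using arccos_cos[of "B + C"] bounds by (simp add: cos_sum)
  also have "\<dots> = pi - arccos (c / (a * b))"
  proof (rule arccos_minus)
    have "\<bar>c / (a * b)\<bar> \<le> 1"
      using c assms(1,2) by (simp add: abs_mult)
    then show "- 1 \<le> c / (a * b)" "c / (a * b) \<le> 1"
      by linarith+
  qed
  finally show ?thesis
    by (simp add: B_def C_def)
qed

context complex_inner_product_space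
begin

text \<open>This is Cauchy-Schwarz divided by the norms; if one of them vanishes, the quotient is 0
  by the convention for division by 0.\<close>

lemma ip_quotient_norm_le_1: "cmod (ip x y / complex_of_real (ip_norm ip x * ip_norm ip y)) \<le> 1"
proof -
  have "0 \<le> ip_norm ip x * ip_norm ip y"
    by (simp add: ip_norm_nonneg)
  then show ?thesis
    using ip_Cauchy_Schwarz[of x y]
    by (simp add: norm_divide divide_le_eq_1 order_less_le del: of_real_mult) auto
qed

text \<open>The quotient lies in the closed unit disc, which misses the two real rays removed from
  \<open>arccos_domain\<close>.\<close>

lemma ip_angle_eq_Arccos:
  "ip_angle ip x y = Arccos (ip x y / complex_of_real (ip_norm ip x * ip_norm ip y))"
  unfolding ip_angle_def
proof (rule complex_arccos_eq_Arccos)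
  show "ip x y / complex_of_real (ip_norm ip x * ip_norm ip y) \<in> arccos_domain"
    using ip_quotient_norm_le_1[of x y]
    by (auto simp: arccos_domain_def simp del: of_real_mult)
qed

lemma ip_angle_of_real:
  assumes "ip x y = complex_of_real c"
  shows "ip_angle ip x y = complex_of_real (arccos (c / (ip_norm ip x * ip_norm ip y)))"
proof -
  have q: "ip x y / complex_of_real (ip_norm ip x * ip_norm ip y)
      = complex_of_real (c / (ip_norm ip x * ip_norm ip y))"
    by (simp add: assms)
  have "\<bar>c / (ip_norm ip x * ip_norm ip y)\<bar> \<le> 1"
    using ip_quotient_norm_le_1[of x y] unfolding q norm_of_real .
  then show ?thesis
    unfolding ip_angle_eq_Arccos q by (rule of_real_arccos[symmetric])
qed

lemma ip_real_if_angle_real: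
  assumes "x \<noteq> 0" "y \<noteq> 0" "ip_angle ip x y \<in> \<real>"
  shows "ip x y \<in> \<real>"
proof -
  define m where "m = ip_norm ip x * ip_norm ip y"
  obtain t where t: "ip_angle ip x y = complex_of_real t"
    using assms(3) by (auto elim: Reals_cases)
  have "m \<noteq> 0"
    using assms(1,2) by (simp add: m_def)
  \<comment> \<open>\<open>cos\<close> undoes \<open>Arccos\<close> on the left and stays real at
    the real angle \<open>t\<close>.\<close>
  moreover have "ip x y / complex_of_real m = complex_of_real (cos t)"
    using arg_cong[OF t, of cos] unfolding ip_angle_eq_Arccos m_def
    by (simp only: cos_Arccos cos_of_real)
  ultimately have "ip x y = complex_of_real (cos t * m)"
    by (simp add: field_simps)
  then show ?thesis
    by simp
qed

lemma ip_norm_minus: "ip_norm ip (- x) = ip_norm ip x"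
  by (simp add: ip_norm_def)

lemma ip_angle_triangle_sum:
  assumes "x \<noteq> 0" "y \<noteq> 0" "x \<noteq> y" "ip_angle ip x y \<in> \<real>"
  shows "ip_angle ip x y + ip_angle ip (- x) (y - x) + ip_angle ip (- y) (x - y)
           = complex_of_real pi"
proof -
  define a b n where "a = ip_norm ip x" and "b = ip_norm ip y" and "n = ip_norm ip (x - y)"
  obtain c where xy: "ip x y = complex_of_real c"
    using ip_real_if_angle_real[OF assms(1,2,4)] by (auto elim: Reals_cases)
  have yx: "ip y x = complex_of_real c"
    by (subst ip_commute) (simp add: xy)
  have pos: "a > 0" "b > 0" "n > 0"
    using assms(1-3) by (simp_all add: a_def b_def n_def order_less_le ip_norm_nonneg)
  have c: "\<bar>c\<bar> \<le> a * b"
    using ip_Cauchy_Schwarz[of x y] by (simp add: xy a_def b_def)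
  have n: "n\<^sup>2 = a\<^sup>2 + b\<^sup>2 - 2 * c"
    unfolding n_def a_def b_def ip_norm_power2
    by (simp add: ip_diff_left ip_diff_right xy yx)
  have sym: "ip_norm ip (y - x) = n"
    unfolding n_def by (rule commute)
  \<comment> \<open>These are the numerators of the cosines at the other two vertices; being real,
    they reduce both angles to the real \<open>arccos\<close>.\<close>
  have "ip (- x) (y - x) = complex_of_real (a\<^sup>2 - c)" "ip (- y) (x - y) = complex_of_real (b\<^sup>2 - c)"
    by (simp_all add: ip_diff_right xy yx ip_self a_def b_def)
  from this[THEN ip_angle_of_real]
  have "ip_angle ip (- x) (y - x) = complex_of_real (arccos ((a\<^sup>2 - c) / (a * n)))"
    "ip_angle ip (- y) (x - y) = complex_of_real (arccos ((b\<^sup>2 - c) / (b * n)))"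
    by (simp_all only: ip_norm_minus sym flip: a_def b_def n_def)
  moreover have "ip_angle ip x y = complex_of_real (arccos (c / (a * b)))"
    using ip_angle_of_real[OF xy] by (simp add: a_def b_def)
  ultimately show ?thesis
    using arccos_triangle_sum[OF pos c n] by (simp flip: of_real_add)
qed

end

theorem proposition4p8:
  fixes scale :: "complex \<Rightarrow> 'a::ab_group_add \<Rightarrow> 'a"
    and ip :: "'a \<Rightarrow> 'a \<Rightarrow> complex"
    and x y :: 'a
  assumes "complex_hilbert_space scale ip"
    and "x \<noteq> 0" and "y \<noteq> 0" and "x \<noteq> y"
    and "ip_angle ip x y \<in> \<real>"
  shows "ip_angle ip x y + ip_angle ip (- x) (y - x) + ip_angle ip (- y) (x - y)
           = complex_of_real pi"
proof -
  interpret complex_hilbert_space scale ip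
    by (rule assms(1))
  show ?thesis
    using assms(2-5) by (rule ip_angle_triangle_sum)
qed

end
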